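(* For $\ell>0$ let $C_\ell$ be the round circle of circumference $\ell$ in $\mathbb R^2$, equipped with the Euclidean subspace metric. Then its magnitude satisfies \[|C_\ell| = \ell/2+q_3(\ell),\] where $q_3(\ell)\to 0$ as $\ell\to\infty$.
   Context: A weighting on a finite metric space $(W,d)$ is a choice of real number $w_x$ for each $x\in W$ such that $\sum_{x'\in W} e^{-d(x,x')}w_{x'}=1$ for every $x\in W$. If a weighting exists, the magnitude of $W$ is $|W| := \sum_{x\in W} w_x$; this is independent of the choice of weighting. A metric space $X$ is positive definite if for every finite subspace $W\subseteq X$ the matrix $(e^{-d(x,x')})_{x,x'\in W}$ is positive definite; subspaces of Euclidean space are positive definite, and finite positive definite spaces have a well-defined magnitude. The magnitude of a compact positive definite metric space $X$ is defined as $|X| := \sup\{|W| : W\subseteq X\text{ finite}\}$; equivalently (a result of Meckes), $|X|=\lim_{k}|X_k|$ for any sequence $(X_k)$ of finite subsets of $X$ converging to $X$ in the Hausdorff metric. In $C_\ell$ (radius $\ell/2\pi$), the distance between two points subtending an angle $\theta$ at the centre is $\frac{\ell}{\pi}\sin\frac{\theta}{2}$. *)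

theory Defs
  imports "HOL-Analysis.Analysis"
begin

text \<open>
  A finite metric space is represented as a finite subset of an ambient metric space; only the
  values of a weighting on that subset matter.
\<close>

definition weighting_on :: "'a::metric_space set \<Rightarrow> ('a \<Rightarrow> real) \<Rightarrow> bool" where
  "weighting_on W w \<longleftrightarrow> finite W \<and> (\<forall>x\<in>W. (\<Sum>y\<in>W. exp (- dist x y) * w y) = 1)"

lemma weighting_on_sum_unique:
  assumes v: "weighting_on W v" and w: "weighting_on W w"
  shows "sum v W = sum w W"
proof -
  have "sum v W = (\<Sum>x\<in>W. v x * (\<Sum>y\<in>W. exp (- dist x y) * w y))"
    using w by (simp add: weighting_on_def)
  also have "\<dots> = (\<Sum>x\<in>W. \<Sum>y\<in>W. exp (- dist x y) * v x * w y)"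
    by (simp add: sum_distrib_left mult_ac)
  also have "\<dots> = (\<Sum>y\<in>W. \<Sum>x\<in>W. exp (- dist x y) * v x * w y)"
    by (rule sum.swap)
  also have "\<dots> = (\<Sum>y\<in>W. (\<Sum>x\<in>W. exp (- dist y x) * v x) * w y)"
    by (simp add: sum_distrib_right dist_commute)
  also have "\<dots> = sum w W"
    using v by (simp add: weighting_on_def)
  finally show ?thesis .
qed

text \<open>
  The common total weight of all weightings; unspecified if there is no weighting.
\<close>

definition finite_magnitude :: "'a::metric_space set \<Rightarrow> real" where
  "finite_magnitude W = (THE m. \<exists>w. weighting_on W w \<and> m = sum w W)"

lemma finite_magnitude_eq:
  assumes "weighting_on W w"
  shows "finite_magnitude W = sum w W"
  unfolding finite_magnitude_def
  using assms weighting_on_sum_unique by (intro the_equality) blast+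

text \<open>
  The definition is meaningful for compact positive definite spaces, in particular for compact
  subsets of Euclidean space, where every finite subset has a weighting. The supremum is taken in
  the extended reals, so that a real value of the magnitude includes boundedness of the magnitudes
  of the finite subsets.
\<close>

definition magnitude :: "'a::metric_space set \<Rightarrow> ereal" where
  "magnitude X = (SUP W\<in>{W. W \<subseteq> X \<and> finite W}. ereal (finite_magnitude W))"

definition round_circle :: "real \<Rightarrow> (real ^ 2) set" where
  "round_circle l = sphere 0 (l / (2 * pi))"

end

theory Submission
  imports Defs "HOL-Real_Asymp.Real_Asymp"
begin

text \<open>
  Let \<open>r\<close> be the radius, \<open>a = 2 * r\<close> and let \<open>A\<close> be the mean of \<open>exp (- dist x y)\<close> over \<open>y\<close> in the circle.
  By symmetry the uniform measure has constant potential \<open>A\<close>, and the magnitude is \<open>1 / A\<close>: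
  regular polygons, whose weighting is constant, have magnitude tending to \<open>1 / A\<close>, and a
  Cauchy--Schwarz inequality against the uniform measure,
  \<open>A * (\<Sum>x. v x)\<^sup>2 \<le> (\<Sum>x y. v x * v y * exp (- dist x y))\<close>, bounds every finite subset. The
  same inequality shows that weightings exist. It is obtained as a limit of its analogue on
  \<open>N\<close>-gons, where it follows from the convexity of \<open>exp (- (a * sin t))\<close> on \<open>[0, \<pi>]\<close>: if \<open>v\<close> has
  sum zero it is a difference \<open>g (k + 1) - g k\<close>, and summation by parts turns its energy into
  half the sum of \<open>D (x - y) * (g x - g y)\<^sup>2\<close>, with \<open>D\<close> the second difference of the kernel. Finally
  \<open>1 / A - \<pi> * a / 2 \<longrightarrow> 0\<close> is read off from elementary bounds for the integral \<open>A\<close>.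
\<close>

section \<open>Finite quadratic forms\<close>

lemma sum_periodic_shift:
  fixes h :: "int \<Rightarrow> 'a::comm_monoid_add"
  assumes N: "N > 0" and per: "\<And>k. h (k mod N) = h k"
  shows "(\<Sum>k\<in>{0..<N}. h (k + c)) = (\<Sum>k\<in>{0..<N}. h k)"
proof (rule sum.reindex_bij_witness[where i = "\<lambda>k. (k - c) mod N" and j = "\<lambda>k. (k + c) mod N"])
  fix k assume k: "k \<in> {0..<N}"
  show "((k + c) mod N - c) mod N = k" "((k - c) mod N + c) mod N = k"
    using k by (simp_all add: mod_simps)
qed (use N per in auto)

text \<open>Write \<open>V = v + c\<close> with \<open>v\<close> of sum zero. All rows and columns
  of the circulant matrix have the same sum \<open>T\<close>, so the cross terms vanish and the
  constant part contributes \<open>c\<^sup>2 * (N * T)\<close>; what remains is that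
  \<open>v\<close> has nonnegative energy.\<close>

lemma cyclic_convex_energy:
  fixes F V :: "int \<Rightarrow> real" and N :: int
  assumes N: "N > 0" and per: "\<And>k. F (k mod N) = F k" and even: "\<And>k. F (- k) = F k"
    and convex: "\<And>k. 0 < k \<Longrightarrow> k < N \<Longrightarrow> 2 * F k \<le> F (k + 1) + F (k - 1)"
  shows "(\<Sum>k\<in>{0..<N}. F k) * (\<Sum>k\<in>{0..<N}. V k)\<^sup>2
    \<le> N * (\<Sum>x\<in>{0..<N}. \<Sum>y\<in>{0..<N}. V x * V y * F (x - y))"
proof -
  define I where "I = {0..<N}"
  define T where "T = (\<Sum>k\<in>I. F k)"
  define c where "c = (\<Sum>k\<in>I. V k) / N"
  define v where "v = (\<lambda>k. V k - c)"
  \<comment> \<open>Discrete primitive of \<open>v\<close>. Reducing the index mod \<open>N\<close>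
    makes it periodic, and it stays a primitive at the wrap-around from \<open>N - 1\<close> to
    \<open>0\<close> because \<open>v\<close> has sum zero.\<close>
  define g where "g = (\<lambda>k. \<Sum>j\<in>{0..<k mod N}. v j)"
  define D where "D = (\<lambda>k. F (k + 1) + F (k - 1) - 2 * F k)"
  have cong: "F k = F m" if "k mod N = m mod N" for k m
    using that per by metis
  have F_mod_left: "F (k mod N + b) = F (k + b)" for k b by (rule cong) (simp add: mod_simps)
  have F_mod_right: "F (b - k mod N) = F (b - k)" for k b by (rule cong) (simp add: mod_simps)
  have cardI: "real (card I) = N" using N by (simp add: I_def)
  have V: "V k = v k + c" for k by (simp add: v_def)
  have sumv: "sum v I = 0"
    using N by (simp add: v_def sum_subtractf cardI c_def)
  have g_per: "g (k mod N) = g k" for k by (simp add: g_def)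
  have g_step: "g (k + 1) - g k = v k" if "k \<in> I" for k
  proof (cases "k + 1 = N")
    case True
    have "{0..<N} = insert k {0..<k}" using True N by auto
    then have "sum v {0..<k} + v k = 0" using sumv by (simp add: I_def)
    then show ?thesis using True that by (simp add: g_def I_def)
  next
    case False
    have "{0..<k+1} = insert k {0..<k}" using that by (auto simp: I_def)
    then show ?thesis using False that by (simp add: g_def I_def)
  qed
  have shift: "(\<Sum>k\<in>I. h (k + s)) = (\<Sum>k\<in>I. h k)"
    if "\<And>k. h (k mod N) = h k" for h :: "int \<Rightarrow> real" and s
    unfolding I_def using N that by (rule sum_periodic_shift)
  have rows: "(\<Sum>y\<in>I. h (x - y)) = (\<Sum>k\<in>I. h k)"
    if "\<And>k. h (k mod N) = h k" "\<And>k. h (- k) = h k" for h :: "int \<Rightarrow> real" and x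
  proof -
    have "h (x - y) = h (y + - x)" for y using that(2)[of "y - x"] by simp
    then show ?thesis using shift[of h "- x"] that(1) by simp
  qed
  have D_per: "D (k mod N) = D k" for k
    unfolding D_def by (intro arg_cong2[of _ _ _ _ "(+)"] arg_cong2[of _ _ _ _ "(-)"] arg_cong2[of _ _ _ _ "(*)"] cong refl)
      (simp_all add: mod_simps)
  have D_even: "D (- k) = D k" for k
    using even[of "k - 1"] even[of "k + 1"] even[of k] by (simp add: D_def)
  have sumD: "sum D I = 0"
    using shift[of F 1] shift[of F "- 1"] per
    by (simp add: D_def sum.distrib sum_subtractf flip: sum_distrib_left)
  have colD: "(\<Sum>x\<in>I. D (x - y)) = 0" for y
    using shift[of D "- y"] D_per sumD by simp
  have rowD: "(\<Sum>y\<in>I. D (x - y)) = 0" for x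
    using rows[of D x] D_per D_even sumD by simp
  have D_nonneg: "D (x - y) * (g x - g y)\<^sup>2 \<ge> 0" if "x \<in> I" "y \<in> I" for x y
  proof -
    \<comment> \<open>On the diagonal the square vanishes, so the peak of the kernel, where
      \<open>D\<close> may be negative, does no harm; off the diagonal convexity applies to
      \<open>\<bar>x - y\<bar>\<close>.\<close>
    consider "x = y" | "0 < x - y" "x - y < N" | "0 < y - x" "y - x < N"
      using \<open>x \<in> I\<close> \<open>y \<in> I\<close> by (force simp: I_def)
    then show ?thesis
    proof cases
      case 2
      then show ?thesis using convex[of "x - y"] by (simp add: D_def)
    next
      case 3
      then show ?thesis using convex[of "y - x"] D_even[of "y - x"] by (simp add: D_def)
    qed simp
  qed
  \<comment> \<open>Energies of shifted copies of \<open>g\<close>. Periodicity lets both shifts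
    move into the kernel, so the four terms of \<open>(g (x + 1) - g x) * (g (y + 1) - g y)\<close>
    combine into a second difference of \<open>F\<close>.\<close>
  define E where "E = (\<lambda>s t u. \<Sum>x\<in>I. \<Sum>y\<in>I. g (x + s) * g (y + t) * F (x - y + u))"
  have E_shift: "E s t u = E 0 0 (u - s + t)" for s t u
  proof -
    have "E s t u = (\<Sum>x\<in>I. \<Sum>y\<in>I. g (x + s) * g y * F (x - y + u + t))"
      unfolding E_def
    proof (rule sum.cong[OF refl])
      fix x
      show "(\<Sum>y\<in>I. g (x + s) * g (y + t) * F (x - y + u)) = (\<Sum>y\<in>I. g (x + s) * g y * F (x - y + u + t))"
        using shift[of "\<lambda>y. g (x + s) * g y * F (x + u + t - y)" t]
        by (simp add: g_per F_mod_right algebra_simps)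
    qed
    also have "\<dots> = (\<Sum>y\<in>I. \<Sum>x\<in>I. g (x + s) * g y * F (x - y + u + t))"
      by (rule sum.swap)
    also have "\<dots> = (\<Sum>y\<in>I. \<Sum>x\<in>I. g x * g y * F (x - y + u + t - s))"
    proof (rule sum.cong[OF refl])
      fix y
      show "(\<Sum>x\<in>I. g (x + s) * g y * F (x - y + u + t)) = (\<Sum>x\<in>I. g x * g y * F (x - y + u + t - s))"
        using shift[of "\<lambda>x. g x * g y * F (x + (u + t - s - y))" s]
        by (simp add: g_per F_mod_left) (simp add: algebra_simps)
    qed
    also have "\<dots> = (\<Sum>x\<in>I. \<Sum>y\<in>I. g x * g y * F (x - y + u + t - s))"
      by (rule sum.swap)
    finally show ?thesis by (simp add: E_def algebra_simps)
  qed
  have "(\<Sum>x\<in>I. \<Sum>y\<in>I. v x * v y * F (x - y)) 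
      = (\<Sum>x\<in>I. \<Sum>y\<in>I. (g (x + 1) - g x) * (g (y + 1) - g y) * F (x - y))"
    by (intro sum.cong refl) (simp add: g_step)
  also have "\<dots> = E 1 1 0 - E 1 0 0 - E 0 1 0 + E 0 0 0"
    by (simp add: E_def algebra_simps sum.distrib sum_subtractf)
  also have "\<dots> = 2 * E 0 0 0 - E 0 0 (-1) - E 0 0 1"
    using E_shift[of 1 1 0] E_shift[of 1 0 0] E_shift[of 0 1 0] by simp
  also have "\<dots> = (\<Sum>x\<in>I. \<Sum>y\<in>I. g x * g y * (2 * F (x - y) - F (x - y - 1) - F (x - y + 1)))"
    by (simp add: E_def algebra_simps sum.distrib sum_subtractf sum_distrib_left)
  \<comment> \<open>Polarization: \<open>2 * g x * g y = (g x)\<^sup>2 + (g y)\<^sup>2 - (g x - g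
    y)\<^sup>2\<close>. The pure squares drop out afterwards because rows and columns of
    \<open>D\<close> sum to zero.\<close>
  also have "\<dots> = (\<Sum>x\<in>I. \<Sum>y\<in>I. (D (x - y) * (g x - g y)\<^sup>2 - (g x)\<^sup>2 * D (x - y) - (g y)\<^sup>2 * D (x - y)) / 2)"
    by (intro sum.cong refl) (simp add: D_def power2_eq_square field_simps)
  also have "\<dots> = ((\<Sum>x\<in>I. \<Sum>y\<in>I. D (x - y) * (g x - g y)\<^sup>2) - (\<Sum>x\<in>I. (g x)\<^sup>2 * (\<Sum>y\<in>I. D (x - y))) 
      - (\<Sum>x\<in>I. \<Sum>y\<in>I. (g y)\<^sup>2 * D (x - y))) / 2"
    by (simp add: sum_subtractf sum_divide_distrib sum_distrib_left diff_divide_distrib)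
  also have "(\<Sum>x\<in>I. \<Sum>y\<in>I. (g y)\<^sup>2 * D (x - y)) = (\<Sum>y\<in>I. (g y)\<^sup>2 * (\<Sum>x\<in>I. D (x - y)))"
    by (subst sum.swap) (simp add: sum_distrib_left)
  finally have "(\<Sum>x\<in>I. \<Sum>y\<in>I. v x * v y * F (x - y)) =
      (\<Sum>x\<in>I. \<Sum>y\<in>I. D (x - y) * (g x - g y)\<^sup>2) / 2"
    by (simp add: colD rowD)
  also have "\<dots> \<ge> 0"
    using D_nonneg by (simp add: sum_nonneg)
  finally have Qv: "(\<Sum>x\<in>I. \<Sum>y\<in>I. v x * v y * F (x - y)) \<ge> 0" .
  have colF: "(\<Sum>x\<in>I. F (x - y)) = T" for y
    using shift[of F "- y"] per by (simp add: T_def)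
  have rowF: "(\<Sum>y\<in>I. F (x - y)) = T" for x
    using rows[of F x] per even by (simp add: T_def)
  have "(\<Sum>x\<in>I. \<Sum>y\<in>I. V x * V y * F (x - y)) = 
     (\<Sum>x\<in>I. \<Sum>y\<in>I. v x * v y * F (x - y)) + c * (\<Sum>x\<in>I. v x * (\<Sum>y\<in>I. F (x - y)))
      + c * (\<Sum>x\<in>I. \<Sum>y\<in>I. v y * F (x - y)) + c\<^sup>2 * (\<Sum>x\<in>I. \<Sum>y\<in>I. F (x - y))"
    by (simp add: V algebra_simps sum.distrib sum_distrib_left power2_eq_square)
  also have "(\<Sum>x\<in>I. \<Sum>y\<in>I. v y * F (x - y)) = (\<Sum>y\<in>I. v y * (\<Sum>x\<in>I. F (x - y)))"
    by (subst sum.swap) (simp add: sum_distrib_left)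
  finally have "(\<Sum>x\<in>I. \<Sum>y\<in>I. V x * V y * F (x - y)) \<ge> c\<^sup>2 * (N * T)"
    using Qv by (simp add: colF rowF cardI sumv flip: sum_distrib_right)
  then have "N * (c\<^sup>2 * (N * T)) \<le> N * (\<Sum>x\<in>I. \<Sum>y\<in>I. V x * V y * F (x - y))"
    using N by (intro mult_left_mono) auto
  moreover have "N * (c\<^sup>2 * (N * T)) = T * (sum V I)\<^sup>2"
    using N by (simp add: c_def power2_eq_square)
  ultimately show ?thesis by (simp only: I_def T_def)
qed

text \<open>The bound makes the form positive semidefinite and forces \<open>b\<close> to vanish on
  its null vectors, which is the solvability condition. The induction is Gaussian elimination; each
  step preserves the bound with the same \<open>C\<close>.\<close>

lemma solvable_of_bounded_functional:
  fixes K :: "'a \<Rightarrow> 'a \<Rightarrow> real" and b :: "'a \<Rightarrow> real"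
  assumes "finite W" and C: "C > 0" and "\<And>x y. K x y = K y x"
    and "\<And>v. (\<Sum>x\<in>W. b x * v x)\<^sup>2 \<le> C * (\<Sum>x\<in>W. \<Sum>y\<in>W. v x * v y * K x y)"
  shows "\<exists>w. \<forall>x\<in>W. (\<Sum>y\<in>W. K x y * w y) = b x"
  using assms(1,3,4)
proof (induction W arbitrary: K b rule: finite_induct)
  case empty
  then show ?case by simp
next
  case (insert z W)
  note sym = insert.prems(1)
  have z: "z \<notin> W" "finite W" by fact+
  let ?q = "\<lambda>v. \<Sum>x\<in>W. \<Sum>y\<in>W. v x * v y * K x y"
  have bound: "(b z * t + (\<Sum>x\<in>W. b x * v x))\<^sup>2
      \<le> C * (K z z * t\<^sup>2 + 2 * t * (\<Sum>x\<in>W. K z x * v x) + ?q v)" for t v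
  proof -
    let ?u = "v(z := t)"
    have upd: "x \<noteq> z" if "x \<in> W" for x using that z by blast
    have 1: "(\<Sum>x\<in>insert z W. b x * ?u x) = b z * t + (\<Sum>x\<in>W. b x * v x)"
      using z upd by (simp cong: sum.cong)
    have "(\<Sum>x\<in>insert z W. \<Sum>y\<in>insert z W. ?u x * ?u y * K x y)
       = t * t * K z z + (\<Sum>y\<in>W. t * v y * K z y) + (\<Sum>x\<in>W. v x * t * K x z + (\<Sum>y\<in>W. v x * v y * K x y))"
      using z upd by (simp cong: sum.cong)
    also have "\<dots> = K z z * t\<^sup>2 + 2 * t * (\<Sum>x\<in>W. K z x * v x) + ?q v"
    proof -
      have "(\<Sum>x\<in>W. v x * t * K x z) = (\<Sum>x\<in>W. t * v x * K z x)"
        by (intro sum.cong refl) (metis sym mult.commute)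
      then show ?thesis
        by (simp add: sum.distrib sum_distrib_left power2_eq_square mult_ac)
    qed
    finally show ?thesis using insert.prems(2)[of ?u] unfolding 1 by simp
  qed
  have Kzz: "K z z \<ge> 0"
  proof -
    have "0 \<le> (b z)\<^sup>2" by simp
    also have "\<dots> \<le> C * K z z" using bound[of 1 "\<lambda>_. 0"] by simp
    finally show ?thesis using C by (simp add: zero_le_mult_iff)
  qed
  show ?case
  proof (cases "K z z = 0")
    case True
    have bz: "b z = 0" using bound[of 1 "\<lambda>_. 0"] True by simp
    have Kz: "K z x = 0" if x: "x \<in> W" for x
    proof (rule ccontr)
      assume ne: "K z x \<noteq> 0"
      let ?v = "\<lambda>y. if y = x then 1 else 0 :: real"
      \<comment> \<open>With a vanishing pivot the form is affine in \<open>t\<close>; this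
        \<open>t\<close> gives it the value \<open>-1\<close>.\<close>
      define t where "t = - (?q ?v + 1) / (2 * K z x)"
      have "(\<Sum>y\<in>W. K z y * ?v y) = K z x"
        using z x by (simp add: if_distrib cong: if_cong)
      then have "2 * t * (\<Sum>y\<in>W. K z y * ?v y) + ?q ?v = -1"
        using ne by (simp add: t_def field_simps)
      moreover have "0 \<le> C * (K z z * t\<^sup>2 + 2 * t * (\<Sum>y\<in>W. K z y * ?v y) + ?q ?v)"
        by (rule order_trans[OF zero_le_power2 bound])
      ultimately show False using True C by simp
    qed
    have Kz': "K x z = 0" if "x \<in> W" for x using Kz[OF that] sym by metis
    obtain w where w: "\<forall>x\<in>W. (\<Sum>y\<in>W. K x y * w y) = b x"
      using insert.IH[of K b, OF sym] bound[of 0] by auto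
    have "\<forall>x\<in>insert z W. (\<Sum>y\<in>insert z W. K x y * w y) = b x"
      using z w bz True Kz Kz' by simp
    then show ?thesis by blast
  next
    case False
    \<comment> \<open>Eliminate \<open>z\<close>: pass to the Schur complement.\<close>
    define p where "p = K z z"
    have p: "p > 0" using False Kzz by (simp add: p_def)
    define K' where "K' = (\<lambda>x y. K x y - K z x * K z y / p)"
    have K'_sym: "K' x y = K' y x" for x y using sym[of x y] by (simp add: K'_def)
    define b' where "b' = (\<lambda>x. b x - K z x * b z / p)"
    have "(\<Sum>x\<in>W. b' x * v x)\<^sup>2 \<le> C * (\<Sum>x\<in>W. \<Sum>y\<in>W. v x * v y * K' x y)" for v
    proof -
      \<comment> \<open>\<open>- s / p\<close> is the value of the coordinate at \<open>z\<close>
        that minimizes the form, and the minimum is the energy of \<open>v\<close> under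
        \<open>K'\<close>. Hence \<open>bound\<close> at this value is the bound for the reduced
        system.\<close>
      define s where "s = (\<Sum>x\<in>W. K z x * v x)"
      have 1: "(\<Sum>x\<in>W. b' x * v x) = b z * (- s / p) + (\<Sum>x\<in>W. b x * v x)"
        by (simp add: b'_def s_def algebra_simps sum_subtractf sum_distrib_left sum_divide_distrib)
      have "(\<Sum>x\<in>W. \<Sum>y\<in>W. v x * v y * K' x y) = ?q v - s * s / p"
        unfolding s_def sum_product
        by (simp add: K'_def algebra_simps sum_subtractf sum_divide_distrib)
      also have "\<dots> = K z z * (- s / p)\<^sup>2 + 2 * (- s / p) * s + ?q v"
        using p by (simp add: p_def[symmetric] power2_eq_square field_simps)
      finally show ?thesis
        using bound[of "- s / p" v] unfolding 1 s_def[symmetric] by simp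
    qed
    then obtain w where w: "\<forall>x\<in>W. (\<Sum>y\<in>W. K' x y * w y) = b' x"
      using insert.IH[of K' b'] K'_sym by blast
    define s where "s = (\<Sum>x\<in>W. K z x * w x)"
    \<comment> \<open>Back-substitution: the value at \<open>z\<close> is dictated by row
      \<open>z\<close>.\<close>
    define u where "u = w(z := (b z - s) / p)"
    have u: "(\<Sum>y\<in>insert z W. K x y * u y) = K x z * (b z - s) / p + (\<Sum>y\<in>W. K x y * w y)" for x
    proof -
      have "(\<Sum>y\<in>W. K x y * u y) = (\<Sum>y\<in>W. K x y * w y)"
        using z by (intro sum.cong) (auto simp: u_def)
      then show ?thesis using z by (simp add: u_def)
    qed
    have "(\<Sum>y\<in>insert z W. K x y * u y) = b x" if x: "x \<in> insert z W" for x
    proof (cases "x = z")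
      case True
      then show ?thesis using p unfolding u by (simp add: p_def[symmetric] s_def)
    next
      case False
      then have "(\<Sum>y\<in>W. K' x y * w y) = b' x" using w x by auto
      moreover have "(\<Sum>y\<in>W. K' x y * w y) = (\<Sum>y\<in>W. K x y * w y) - K z x * s / p"
        by (simp add: K'_def s_def algebra_simps sum_subtractf sum_distrib_left sum_divide_distrib)
      ultimately show ?thesis using p unfolding u b'_def by (simp add: sym[of x z] field_simps)
    qed
    then show ?thesis by blast
  qed
qed

section \<open>The kernel on the circle\<close>

text \<open>The parameter is half the central angle, so that distances become \<open>2 * r * \<bar>sin (s - t)\<bar>\<close>.\<close>
definition circle_point :: "real \<Rightarrow> real \<Rightarrow> real ^ 2" where
  "circle_point r u = vector [r * cos (2 * u), r * sin (2 * u)]"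

lemma dist_circle_point:
  assumes "r \<ge> 0"
  shows "dist (circle_point r s) (circle_point r t) = 2 * r * \<bar>sin (s - t)\<bar>"
proof -
  have "(cos (2 * s) - cos (2 * t))\<^sup>2 + (sin (2 * s) - sin (2 * t))\<^sup>2 = 2 - 2 * cos (2 * s - 2 * t)"
    using sin_cos_squared_add3[of "2 * s"] sin_cos_squared_add3[of "2 * t"]
    by (simp add: cos_diff power2_eq_square algebra_simps)
  also have "cos (2 * s - 2 * t) = 1 - 2 * (sin (s - t))\<^sup>2"
    using cos_double_sin[of "s - t"] by (simp add: algebra_simps)
  finally have "(cos (2 * s) - cos (2 * t))\<^sup>2 + (sin (2 * s) - sin (2 * t))\<^sup>2 = (2 * sin (s - t))\<^sup>2"
    by (simp add: power2_eq_square)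
  moreover have "(dist (circle_point r s) (circle_point r t))\<^sup>2
      = r\<^sup>2 * ((cos (2 * s) - cos (2 * t))\<^sup>2 + (sin (2 * s) - sin (2 * t))\<^sup>2)"
  proof -
    have "(dist (circle_point r s) (circle_point r t))\<^sup>2
        = (r * (cos (2 * s) - cos (2 * t)))\<^sup>2 + (r * (sin (2 * s) - sin (2 * t)))\<^sup>2"
      by (simp add: dist_vec_def L2_set_def sum_2 circle_point_def dist_real_def right_diff_distrib)
    then show ?thesis by (simp only: power_mult_distrib distrib_left)
  qed
  ultimately have "(dist (circle_point r s) (circle_point r t))\<^sup>2 = (2 * r * \<bar>sin (s - t)\<bar>)\<^sup>2"
    by (simp add: power_mult_distrib)
  then show ?thesis using assms by (simp add: power2_eq_iff_nonneg)
qed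

lemma circle_point_in_sphere: "r \<ge> 0 \<Longrightarrow> circle_point r u \<in> sphere 0 r"
proof -
  assume "r \<ge> 0"
  have "norm (circle_point r u) = sqrt (r\<^sup>2 * ((sin (2 * u))\<^sup>2 + (cos (2 * u))\<^sup>2))"
    by (simp only: norm_vec_def L2_set_def sum_2 circle_point_def)
      (simp add: power_mult_distrib algebra_simps del: sin_cos_squared_add sin_cos_squared_add2)
  then show ?thesis using \<open>r \<ge> 0\<close> by simp
qed

lemma sphere_eq_circle_point:
  fixes x :: "real ^ 2"
  assumes "r > 0" "x \<in> sphere 0 r"
  shows "\<exists>u. 0 \<le> u \<and> u < pi \<and> x = circle_point r u"
proof -
  have "sqrt ((x $ 1)\<^sup>2 + (x $ 2)\<^sup>2) = r"
    using assms by (simp add: norm_vec_def L2_set_def sum_2)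
  then have "(x $ 1)\<^sup>2 + (x $ 2)\<^sup>2 = r\<^sup>2"
    by (metis real_sqrt_ge_0_iff real_sqrt_pow2_iff sum_power2_ge_zero)
  then have "(x $ 1 / r)\<^sup>2 + (x $ 2 / r)\<^sup>2 = 1"
    using assms by (simp add: field_simps)
  then obtain t where "0 \<le> t" "t < 2 * pi" "x $ 1 / r = cos t" "x $ 2 / r = sin t"
    using sincos_total_2pi by metis
  then show ?thesis
    using assms by (intro exI[of _ "t / 2"])
      (auto simp: circle_point_def vec_eq_iff forall_2 field_simps)
qed

lemma abs_sin_diff_int_pi: "\<bar>sin (x - of_int m * pi)\<bar> = \<bar>sin x\<bar>"
proof -
  have "sin (of_int m * pi) = 0" by (simp add: sin_times_pi_eq_0)
  moreover have "\<bar>cos (of_int m * pi)\<bar> = 1"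
    using sin_cos_squared_add[of "of_int m * pi"] calculation by (simp add: abs_square_eq_1)
  ultimately show ?thesis by (simp add: sin_diff abs_mult)
qed

text \<open>Here \<open>a\<close> is the diameter, and \<open>k\<close> the number of steps between two vertices of the regular \<open>N\<close>-gon.\<close>
definition chord_kernel :: "real \<Rightarrow> int \<Rightarrow> int \<Rightarrow> real" where
  "chord_kernel a N k = exp (- (a * \<bar>sin (pi * k / N)\<bar>))"

lemma chord_kernel_mod:
  assumes "N > 0" shows "chord_kernel a N (k mod N) = chord_kernel a N k"
proof -
  have "real_of_int (k mod N) = of_int k - of_int (k div N) * of_int N"
    by (simp add: minus_div_mult_eq_mod [symmetric])
  then have "pi * of_int (k mod N) / of_int N = pi * of_int k / of_int N - of_int (k div N) * pi"
    using assms by (simp add: right_diff_distrib diff_divide_distrib)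
  then show ?thesis by (simp only: chord_kernel_def abs_sin_diff_int_pi)
qed

lemma chord_kernel_minus: "chord_kernel a N (- k) = chord_kernel a N k"
  by (simp add: chord_kernel_def)

text \<open>The neighbouring sines add up to \<open>2 * sin t * cos h\<close>, at most
  \<open>2 * sin t\<close>; then the arithmetic-geometric mean inequality applies to the
  neighbouring values, with square roots \<open>p\<close> and \<open>q\<close>. For
  \<open>0 < k < N\<close> all three angles lie in \<open>[0, pi]\<close>, where the absolute values
  disappear.\<close>

lemma chord_kernel_convex:
  assumes "a \<ge> 0" "0 < k" "k < N"
  shows "2 * chord_kernel a N k \<le> chord_kernel a N (k + 1) + chord_kernel a N (k - 1)"
proof -
  define t h where "t = pi * k / N" and "h = pi / N"
  have arg: "pi * of_int (k + 1) / N = t + h" "pi * of_int (k - 1) / N = t - h"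
    using assms by (simp_all add: t_def h_def field_simps)
  have "0 \<le> pi * of_int (k - 1) / N" "pi * of_int (k + 1) / N \<le> pi"
    using assms mult_left_mono[of "real_of_int (k + 1)" N pi] by (auto simp: divide_le_eq)
  then have th: "0 \<le> t - h" "t + h \<le> pi" by (simp_all only: arg)
  have h: "h > 0" using assms by (simp add: h_def)
  have s: "sin t \<ge> 0" "sin (t + h) \<ge> 0" "sin (t - h) \<ge> 0"
    using th h by (auto intro!: sin_ge_zero)
  define p q where "p = exp (- (a * sin (t + h)) / 2)" and "q = exp (- (a * sin (t - h)) / 2)"
  have "exp (- (a * sin t)) \<le> exp (- (a * (sin t * cos h)))"
    using assms s mult_left_mono[of "cos h" 1 "sin t"] by (simp add: mult_left_mono)
  also have "\<dots> = p * q"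
    by (simp add: p_def q_def exp_add [symmetric] sin_add sin_diff field_simps)
  finally have "2 * exp (- (a * sin t)) \<le> p\<^sup>2 + q\<^sup>2"
    using sum_squares_bound[of p q] by simp
  also have "\<dots> = exp (- (a * sin (t + h))) + exp (- (a * sin (t - h)))"
    by (simp add: p_def q_def exp_double[symmetric])
  finally show ?thesis
    using s unfolding chord_kernel_def arg t_def[symmetric] by simp
qed

text \<open>The potential of the uniform probability measure on a circle of diameter
  \<open>a\<close>: at half central angle \<open>t\<close> the chord is \<open>a * sin t\<close>. In
  modified Bessel and Struve functions it is I_0(a) - L_0(a).\<close>

definition mean_kernel :: "real \<Rightarrow> real" where
  "mean_kernel a = integral {0..pi} (\<lambda>t. exp (- (a * sin t))) / pi"

lemma abs_exp_minus_diff_le: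
  fixes x y :: real assumes "x \<ge> 0" "y \<ge> 0"
  shows "\<bar>exp (- x) - exp (- y)\<bar> \<le> \<bar>x - y\<bar>"
proof -
  have *: "exp (- x) - exp (- y) \<le> y - x" if "0 \<le> x" "x \<le> y" for x y :: real
  proof -
    have "exp (- x) - exp (- y) = exp (- x) * (1 - exp (- (y - x)))"
      by (simp add: algebra_simps flip: exp_add)
    also have "\<dots> \<le> 1 * (1 - exp (- (y - x)))"
      using that by (intro mult_right_mono) auto
    also have "\<dots> \<le> y - x"
    proof -
      define e where "e = exp (- (y - x))"
      have "1 + - (y - x) \<le> e" unfolding e_def by (rule exp_ge_add_one_self)
      then show ?thesis unfolding e_def [symmetric] by simp
    qed
    finally show ?thesis .
  qed
  show ?thesis using *[of x y] *[of y x] assms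
    by (cases "x \<le> y") auto
qed

lemma abs_sin_diff_le: "\<bar>sin x - sin y\<bar> \<le> \<bar>x - y\<bar>" for x y :: real
proof -
  have "\<bar>sin x - sin y\<bar> = 2 * \<bar>sin ((x - y) / 2)\<bar> * \<bar>cos ((x + y) / 2)\<bar>"
    by (simp add: sin_diff_sin abs_mult)
  also have "\<dots> \<le> 2 * \<bar>sin ((x - y) / 2)\<bar> * 1"
    by (intro mult_left_mono) auto
  also have "\<dots> \<le> \<bar>x - y\<bar>" using abs_sin_x_le_abs_x[of "(x - y) / 2"] by simp
  finally show ?thesis .
qed

text \<open>Left Riemann sums. The integrand has Lipschitz constant \<open>a\<close> on
  \<open>[0, pi]\<close>, so by the mean value theorem for the primitive \<open>G\<close> each cell
  has error at most \<open>a * (pi / N)\<^sup>2\<close>; adding \<open>N\<close> cells and dividing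
  by \<open>pi\<close> gives \<open>a * pi / N\<close>.\<close>

lemma chord_mean_limit:
  assumes a: "a \<ge> 0"
  shows "(\<lambda>n. (\<Sum>k\<in>{0..<int (Suc n)}. chord_kernel a (int (Suc n)) k) / real (Suc n)) \<longlonglongrightarrow> mean_kernel a"
proof -
  define f where "f = (\<lambda>t. exp (- (a * sin t)))"
  define G where "G = (\<lambda>t. integral {0..t} f)"
  have cont: "continuous_on A f" for A unfolding f_def by (intro continuous_intros)
  have G': "(G has_vector_derivative f t) (at t within {0..pi})" if "t \<in> {0..pi}" for t
    unfolding G_def using integral_has_vector_derivative[OF cont that] by simp
  have bound: "\<bar>(\<Sum>k\<in>{0..<int N}. chord_kernel a (int N) k) / N - mean_kernel a\<bar> \<le> a * pi / N"
    if N: "N > 0" for N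
  proof -
    define s where "s = (\<lambda>k::nat. pi * k / N)"
    have s: "0 \<le> s k" "s k < s (Suc k)" "s (Suc k) \<le> pi" "s (Suc k) - s k = pi / N" if "k < N" for k
      using N that mult_left_mono[of "real (Suc k)" N pi]
      by (auto simp: s_def divide_le_eq divide_strict_right_mono field_simps simp flip: diff_divide_distrib)
    have step: "\<bar>f (s k) * (pi / N) - (G (s (Suc k)) - G (s k))\<bar> \<le> a * (pi / N) * (pi / N)" if k: "k < N" for k
    proof -
      have "\<exists>z\<in>{s k<..<s (Suc k)}. G (s (Suc k)) - G (s k) = (\<lambda>d. d * f z) (s (Suc k) - s k)"
      proof (rule mvt_simple[OF s(2)[OF k]])
        fix x assume "s k \<le> x" "x \<le> s (Suc k)"
        then show "(G has_derivative (\<lambda>d. d * f x)) (at x within {s k..s (Suc k)})"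
          using G'[of x] s[OF k] unfolding has_vector_derivative_def
          by (auto elim!: has_derivative_subset)
      qed
      then obtain z where z: "s k < z" "z < s (Suc k)" "G (s (Suc k)) - G (s k) = pi / N * f z"
        using s(4)[OF k] by auto
      have "\<bar>f (s k) - f z\<bar> \<le> \<bar>a * sin (s k) - a * sin z\<bar>"
        unfolding f_def using a s[OF k] z
        by (intro abs_exp_minus_diff_le) (auto intro!: mult_nonneg_nonneg sin_ge_zero)
      also have "\<dots> = a * \<bar>sin (s k) - sin z\<bar>"
        using a by (simp add: abs_mult flip: right_diff_distrib)
      also have "\<dots> \<le> a * (pi / N)"
        using a abs_sin_diff_le[of "s k" z] z s(4)[OF k] by (intro mult_left_mono) auto
      finally have "\<bar>f (s k) - f z\<bar> * (pi / N) \<le> a * (pi / N) * (pi / N)"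
        by (intro mult_right_mono) auto
      also have "\<bar>f (s k) - f z\<bar> * (pi / N) = \<bar>f (s k) * (pi / N) - (G (s (Suc k)) - G (s k))\<bar>"
        unfolding z(3) by (subst abs_mult_pos) (auto simp: algebra_simps)
      finally show ?thesis .
    qed
    have "(\<Sum>k<N. G (s (Suc k)) - G (s k)) = G (s N) - G (s 0)"
      by (rule sum_lessThan_telescope)
    also have "\<dots> = pi * mean_kernel a"
      using N by (simp add: s_def G_def mean_kernel_def f_def)
    finally have tele: "(\<Sum>k<N. G (s (Suc k)) - G (s k)) = pi * mean_kernel a" .
    have "(\<Sum>k\<in>{0..<int N}. chord_kernel a (int N) k) = (\<Sum>k<N. chord_kernel a (int N) (int k))"
      by (rule sum.reindex_bij_witness[where i = int and j = nat]) auto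
    also have "\<dots> = (\<Sum>k<N. f (s k))"
    proof (intro sum.cong refl)
      fix k assume "k \<in> {..<N}"
      then have "sin (s k) \<ge> 0" using s[of k] by (intro sin_ge_zero) auto
      then show "chord_kernel a (int N) (int k) = f (s k)"
        by (simp add: chord_kernel_def f_def s_def)
    qed
    finally have "\<bar>pi * ((\<Sum>k\<in>{0..<int N}. chord_kernel a (int N) k) / N - mean_kernel a)\<bar>
        = \<bar>\<Sum>k<N. f (s k) * (pi / N) - (G (s (Suc k)) - G (s k))\<bar>"
      unfolding sum_subtractf[of "\<lambda>k. f (s k) * (pi / N)"] tele
      by (simp add: algebra_simps sum_distrib_left sum_divide_distrib)
    also have "\<dots> \<le> (\<Sum>k<N. a * (pi / N) * (pi / N))"
      using step by (intro order_trans[OF sum_abs] sum_mono) auto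
    also have "\<dots> = pi * (a * pi / N)" using N by simp
    finally have "pi * \<bar>(\<Sum>k\<in>{0..<int N}. chord_kernel a (int N) k) / N - mean_kernel a\<bar> \<le> pi * (a * pi / N)"
      unfolding abs_mult by simp
    then show ?thesis by (simp only: mult_le_cancel_left_pos[OF pi_gt_zero])
  qed
  show ?thesis
  proof (rule Lim_transform2[OF tendsto_const])
    have "(\<lambda>n. a * pi / real (Suc n)) \<longlonglongrightarrow> 0"
      by (rule LIMSEQ_Suc[OF lim_const_over_n])
    then show "(\<lambda>n. mean_kernel a - (\<Sum>k\<in>{0..<int (Suc n)}. chord_kernel a (int (Suc n)) k) / real (Suc n)) \<longlonglongrightarrow> 0"
      by (rule Lim_null_comparison[rotated]) (use bound in \<open>auto simp: abs_minus_commute simp del: of_nat_Suc\<close>)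
  qed
qed

text \<open>Each point of \<open>W\<close> is rounded to a vertex of the regular
  \<open>N\<close>-gon, where \<open>cyclic_convex_energy\<close> applies. The kernel is continuous
  in the angles, so the inequality survives the limit in \<open>N\<close>.\<close>

lemma circle_energy_bound:
  fixes W :: "(real ^ 2) set"
  assumes r: "r > 0" and W: "finite W" "W \<subseteq> sphere 0 r"
  shows "mean_kernel (2 * r) * (\<Sum>x\<in>W. v x)\<^sup>2 \<le> (\<Sum>x\<in>W. \<Sum>y\<in>W. v x * v y * exp (- dist x y))"
proof -
  define a where "a = 2 * r"
  have a: "a > 0" using r by (simp add: a_def)
  obtain u where u: "\<And>x. x \<in> W \<Longrightarrow> 0 \<le> u x \<and> u x < pi \<and> x = circle_point r (u x)"
    using sphere_eq_circle_point[OF r] W by (metis subsetD)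
  \<comment> \<open>Rounding down keeps the index below \<open>N\<close> because
    \<open>u x < pi\<close>, and moves the half angle by at most \<open>pi / N\<close>.\<close>
  define k where "k = (\<lambda>N x. \<lfloor>u x * real N / pi\<rfloor>)"
  have bound: "(\<Sum>j\<in>{0..<int N}. chord_kernel a (int N) j) / N * (\<Sum>x\<in>W. v x)\<^sup>2
      \<le> (\<Sum>x\<in>W. \<Sum>y\<in>W. v x * v y * chord_kernel a (int N) (k N x - k N y))" if N: "N > 0" for N
  proof -
    define I where "I = {0..<int N}"
    have k: "k N x \<in> I" if "x \<in> W" for x
      using u[OF that] N by (auto simp: k_def I_def floor_less_iff field_simps)
    \<comment> \<open>Points of \<open>W\<close> rounded to the same vertex pool their
      weights.\<close>
    define V where "V = (\<lambda>j. \<Sum>x\<in>W. if j = k N x then v x else 0)"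
    have V: "(\<Sum>j\<in>I. V j * h j) = (\<Sum>x\<in>W. v x * h (k N x))" for h
    proof -
      have "(\<Sum>j\<in>I. V j * h j) = (\<Sum>x\<in>W. \<Sum>j\<in>I. if j = k N x then v x * h j else 0)"
        unfolding V_def sum_distrib_right by (subst sum.swap) (auto intro!: sum.cong)
      also have "\<dots> = (\<Sum>x\<in>W. v x * h (k N x))"
        using k by (intro sum.cong) (auto simp: I_def)
      finally show ?thesis .
    qed
    have "(\<Sum>i\<in>I. \<Sum>j\<in>I. V i * V j * chord_kernel a (int N) (i - j))
        = (\<Sum>i\<in>I. V i * (\<Sum>j\<in>I. V j * chord_kernel a (int N) (i - j)))"
      by (simp add: sum_distrib_left mult_ac)
    also have "\<dots> = (\<Sum>x\<in>W. \<Sum>y\<in>W. v x * v y * chord_kernel a (int N) (k N x - k N y))"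
      unfolding V by (simp add: sum_distrib_left mult_ac)
    finally have "(\<Sum>j\<in>I. chord_kernel a (int N) j) * (\<Sum>x\<in>W. v x)\<^sup>2
       \<le> N * (\<Sum>x\<in>W. \<Sum>y\<in>W. v x * v y * chord_kernel a (int N) (k N x - k N y))"
      using cyclic_convex_energy[of "int N" "chord_kernel a (int N)" V] N a V[of "\<lambda>_. 1"]
        chord_kernel_mod chord_kernel_minus chord_kernel_convex[of a] by (simp add: I_def)
    then show ?thesis using N by (simp add: I_def field_simps)
  qed
  have lim: "(\<lambda>n. pi * real_of_int (k (Suc n) x) / real (Suc n)) \<longlonglongrightarrow> u x" for x
  proof (rule Lim_transform2[OF tendsto_const])
    have null: "(\<lambda>n. pi / real (Suc n)) \<longlonglongrightarrow> 0"
      by (rule LIMSEQ_Suc[OF lim_const_over_n])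
    have bd: "\<bar>u x - pi * real_of_int (k N x) / N\<bar> \<le> pi / N" if "N > 0" for N
    proof -
      have le: "\<bar>u x * N / pi - k N x\<bar> \<le> 1" unfolding k_def by linarith
      have "u x - pi * real_of_int (k N x) / N = (u x * N / pi - k N x) * (pi / N)"
        using that by (simp add: field_simps)
      then have "\<bar>u x - pi * real_of_int (k N x) / N\<bar> = \<bar>u x * N / pi - k N x\<bar> * \<bar>pi / N\<bar>"
        by (simp only: abs_mult)
      also have "\<bar>pi / N\<bar> = pi / N" by simp
      finally have "\<bar>u x - pi * real_of_int (k N x) / N\<bar> = \<bar>u x * N / pi - k N x\<bar> * (pi / N)" .
      also have "\<dots> \<le> 1 * (pi / N)"
        using le by (intro mult_right_mono) auto
      finally show ?thesis by simp
    qed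
    then show "(\<lambda>n. u x - pi * real_of_int (k (Suc n) x) / real (Suc n)) \<longlonglongrightarrow> 0"
      by (intro Lim_null_comparison[OF always_eventually null] allI) (simp only: real_norm_def zero_less_Suc)
  qed
  have "(\<lambda>n. chord_kernel a (int (Suc n)) (k (Suc n) x - k (Suc n) y)) \<longlonglongrightarrow> exp (- dist x y)"
    if "x \<in> W" "y \<in> W" for x y
  proof -
    have "dist x y = a * \<bar>sin (u x - u y)\<bar>"
      using u[OF that(1)] u[OF that(2)] dist_circle_point[of r "u x" "u y"] r by (simp add: a_def)
    moreover have "(\<lambda>n. exp (- (a * \<bar>sin (pi * real_of_int (k (Suc n) x) / real (Suc n)
        - pi * real_of_int (k (Suc n) y) / real (Suc n))\<bar>))) \<longlonglongrightarrow> exp (- (a * \<bar>sin (u x - u y)\<bar>))"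
      by (intro tendsto_intros lim)
    ultimately show ?thesis
      by (simp only: chord_kernel_def of_int_diff of_int_of_nat_eq diff_divide_distrib right_diff_distrib)
  qed
  then have energy: "(\<lambda>n. \<Sum>x\<in>W. \<Sum>y\<in>W. v x * v y * chord_kernel a (int (Suc n)) (k (Suc n) x - k (Suc n) y))
      \<longlonglongrightarrow> (\<Sum>x\<in>W. \<Sum>y\<in>W. v x * v y * exp (- dist x y))"
    by (intro tendsto_sum tendsto_mult_left)
  have "(\<lambda>n. (\<Sum>j\<in>{0..<int (Suc n)}. chord_kernel a (int (Suc n)) j) / real (Suc n) * (\<Sum>x\<in>W. v x)\<^sup>2)
      \<longlonglongrightarrow> mean_kernel a * (\<Sum>x\<in>W. v x)\<^sup>2"
    using a by (intro tendsto_mult_right chord_mean_limit) simp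
  then show ?thesis unfolding a_def[symmetric]
    by (rule LIMSEQ_le[OF _ energy]) (use bound in \<open>auto simp del: of_nat_Suc\<close>)
qed

section \<open>Magnitude of the circle\<close>

lemma mean_kernel_pos:
  assumes "a \<ge> 0" shows "mean_kernel a > 0"
proof -
  have "integral {0..pi} (\<lambda>t. exp (- a)) \<le> integral {0..pi} (\<lambda>t. exp (- (a * sin t)))"
    using assms by (intro integral_le integrable_continuous_real continuous_intros) (simp add: mult_left_le)
  then have "0 < integral {0..pi} (\<lambda>t. exp (- (a * sin t)))"
    by (rule less_le_trans[rotated]) simp
  then show ?thesis by (simp add: mean_kernel_def)
qed

text \<open>The energy bound is the solvability criterion for \<open>b = 1\<close>. Existence makes
  \<open>finite_magnitude\<close> a genuine total weight on every finite subset of the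
  circle.\<close>

lemma circle_weighting_exists:
  fixes W :: "(real ^ 2) set"
  assumes r: "r > 0" and W: "finite W" "W \<subseteq> sphere 0 r"
  shows "\<exists>w. weighting_on W w"
proof -
  have pos: "mean_kernel (2 * r) > 0" using r by (intro mean_kernel_pos) simp
  have "(\<Sum>x\<in>W. 1 * v x)\<^sup>2 \<le> inverse (mean_kernel (2 * r)) * (\<Sum>x\<in>W. \<Sum>y\<in>W. v x * v y * exp (- dist x y))" for v
    using circle_energy_bound[OF assms, of v] pos by (simp add: field_simps)
  then have "\<exists>w. \<forall>x\<in>W. (\<Sum>y\<in>W. exp (- dist x y) * w y) = 1"
    using pos by (intro solvable_of_bounded_functional[OF W(1), of "inverse (mean_kernel (2 * r))"])
      (simp_all add: dist_commute)
  then show ?thesis using W by (simp add: weighting_on_def)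
qed

text \<open>The energy of a weighting equals its total weight \<open>m\<close>, so the energy bound
  reads \<open>mean_kernel (2 * r) * m\<^sup>2 \<le> m\<close>.\<close>

lemma circle_finite_magnitude_le:
  fixes W :: "(real ^ 2) set"
  assumes r: "r > 0" and W: "finite W" "W \<subseteq> sphere 0 r"
  shows "finite_magnitude W \<le> 1 / mean_kernel (2 * r)"
proof -
  have pos: "mean_kernel (2 * r) > 0" using r by (intro mean_kernel_pos) simp
  obtain w where w: "weighting_on W w" using circle_weighting_exists[OF assms] by blast
  define m where "m = sum w W"
  have "(\<Sum>x\<in>W. \<Sum>y\<in>W. w x * w y * exp (- dist x y)) = (\<Sum>x\<in>W. w x * (\<Sum>y\<in>W. exp (- dist x y) * w y))"
    by (simp add: sum_distrib_left mult_ac)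
  also have "\<dots> = m" using w by (simp add: weighting_on_def m_def)
  finally have le: "mean_kernel (2 * r) * m\<^sup>2 \<le> m"
    using circle_energy_bound[OF assms, of w] by (simp add: m_def)
  have "m \<le> 1 / mean_kernel (2 * r)"
  proof (cases "m > 0")
    case True
    with le have "mean_kernel (2 * r) * m \<le> 1" by (simp add: power2_eq_square)
    then show ?thesis using pos by (simp add: field_simps)
  next
    case False
    then show ?thesis using pos by (smt (verit) divide_pos_pos)
  qed
  then show ?thesis using finite_magnitude_eq[OF w] by (simp add: m_def)
qed

definition polygon :: "real \<Rightarrow> nat \<Rightarrow> (real ^ 2) set" where
  "polygon r n = (\<lambda>k. circle_point r (pi * real k / real n)) ` {..<n}"

text \<open>Rotational symmetry gives all rows the same sum \<open>T\<close>, so the constant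
  \<open>1 / T\<close> is a weighting; injectivity of the parametrization makes the number of points
  exactly \<open>n\<close>.\<close>

lemma finite_magnitude_polygon:
  assumes r: "r > 0" and n: "n > 0"
  shows "finite_magnitude (polygon r n) = 1 / ((\<Sum>k\<in>{0..<int n}. chord_kernel (2 * r) (int n) k) / n)"
proof -
  define p where "p = (\<lambda>k::int. circle_point r (pi * k / n))"
  define I where "I = {0..<int n}"
  define T where "T = (\<Sum>k\<in>I. chord_kernel (2 * r) (int n) k)"
  have P: "polygon r n = p ` I"
  proof -
    have "I = int ` {..<n}" by (simp add: I_def image_int_atLeastLessThan lessThan_atLeast0)
    then show ?thesis by (simp add: polygon_def p_def image_image)
  qed
  have kernel: "exp (- dist (p j) (p k)) = chord_kernel (2 * r) (int n) (k - j)" for j k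
    using r chord_kernel_minus[of "2 * r" "int n" "j - k"]
    by (simp add: p_def dist_circle_point)
      (simp add: chord_kernel_def diff_divide_distrib right_diff_distrib)
  have inj: "inj_on p I"
  proof (rule inj_onI)
    fix j k assume jk: "j \<in> I" "k \<in> I" "p j = p k"
    then have "sin (pi * (j - k) / n) = 0"
      using r dist_circle_point[of r "pi * j / n" "pi * k / n"]
      by (simp add: p_def diff_divide_distrib right_diff_distrib)
    then obtain m :: int where "pi * (j - k) / n = m * pi"
      unfolding sin_zero_iff_int2 by blast
    then have "pi * real_of_int (j - k) = pi * real_of_int (m * int n)"
      using n by (simp add: field_simps)
    then have "j - k = m * int n"
      by (simp only: mult_cancel_left pi_neq_zero of_int_eq_iff simp_thms)
    then have "j mod int n = k mod int n" by (metis mod_mult_self2_is_0 mod_eq_dvd_iff dvd_triv_right)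
    then show "j = k" using jk by (simp add: I_def)
  qed
  have row: "(\<Sum>k\<in>I. chord_kernel (2 * r) (int n) (k - j)) = T" for j
    using sum_periodic_shift[of "int n" "chord_kernel (2 * r) (int n)" "- j"] n chord_kernel_mod
    by (simp add: T_def I_def)
  have T: "T > 0"
    unfolding T_def using n by (intro sum_pos) (auto simp: I_def chord_kernel_def)
  have "weighting_on (polygon r n) (\<lambda>_. 1 / T)"
    unfolding weighting_on_def P
    using T by (auto simp: sum.reindex[OF inj] kernel row I_def[symmetric] simp flip: sum_divide_distrib)
       (simp add: I_def)
  then have "finite_magnitude (polygon r n) = n / T"
    using card_image[OF inj] by (simp add: finite_magnitude_eq P) (simp add: I_def)
  then show ?thesis by (simp add: T_def I_def)
qed

lemma magnitude_round_circle:
  assumes l: "l > 0"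
  shows "magnitude (round_circle l) = ereal (1 / mean_kernel (l / pi))"
proof (rule antisym)
  define r where "r = l / (2 * pi)"
  have r: "r > 0" and r2: "l / pi = 2 * r" using l by (simp_all add: r_def)
  have circle: "round_circle l = sphere 0 r" by (simp add: round_circle_def r_def)
  show "magnitude (round_circle l) \<le> ereal (1 / mean_kernel (l / pi))"
    unfolding magnitude_def circle r2 using circle_finite_magnitude_le[OF r]
    by (intro SUP_least) auto
  \<comment> \<open>The index \<open>Suc n\<close> avoids the empty polygon, and positivity of
    \<open>mean_kernel\<close> permits reciprocals in the limit.\<close>
  have "(\<lambda>n. finite_magnitude (polygon r (Suc n))) \<longlonglongrightarrow> 1 / mean_kernel (2 * r)"
    unfolding finite_magnitude_polygon[OF r zero_less_Suc]
    using r mean_kernel_pos[of "2 * r"] by (intro tendsto_intros chord_mean_limit) auto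
  then have "(\<lambda>n. ereal (finite_magnitude (polygon r (Suc n)))) \<longlonglongrightarrow> ereal (1 / mean_kernel (2 * r))"
    by simp
  then show "ereal (1 / mean_kernel (l / pi)) \<le> magnitude (round_circle l)"
    unfolding magnitude_def circle r2
  proof (rule LIMSEQ_le_const2, intro exI allI impI SUP_upper)
    fix n
    show "polygon r (Suc n) \<in> {W. W \<subseteq> sphere 0 r \<and> finite W}"
      using circle_point_in_sphere[of r] r by (auto simp: polygon_def)
  qed
qed

section \<open>Asymptotics\<close>

text \<open>A linear minorant of sine, to dominate the error integrand by an exponential in
  \<open>t\<close>. Up to \<open>pi / 3\<close> the derivative \<open>cos x - 1 / 2\<close> is
  nonnegative; beyond it constants suffice.\<close>

lemma sin_ge_half:
  assumes "0 \<le> t" "t \<le> pi / 2"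
  shows "t / 2 \<le> sin t"
proof (cases "t \<le> pi / 3")
  case True
  have "sin 0 - 0 / 2 \<le> sin t - t / 2"
  proof (rule DERIV_nonneg_imp_nondecreasing[OF assms(1)])
    fix x assume "0 \<le> x" "x \<le> t"
    then have "cos (pi / 3) \<le> cos x" using True by (intro cos_monotone_0_pi_le) auto
    then show "\<exists>y. ((\<lambda>t. sin t - t / 2) has_real_derivative y) (at x) \<and> 0 \<le> y"
      by (intro exI[of _ "cos x - 1 / 2"]) (auto intro!: derivative_eq_intros simp: cos_60)
  qed
  then show ?thesis by simp
next
  case False
  \<comment> \<open>\<open>4 / 5\<close> separates \<open>pi / 4\<close> from
    \<open>sqrt 3 / 2\<close>.\<close>
  have "t / 2 \<le> 4 / 5" using assms pi_less_4 pi_approx by simp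
  also have "\<dots> \<le> sqrt 3 / 2"
    using real_le_rsqrt[of "8 / 5" 3] by (simp add: power2_eq_square)
  also have "\<dots> = sin (pi / 3)" by (simp add: sin_60)
  also have "\<dots> \<le> sin t" using False assms by (intro sin_monotone_2pi_le) auto
  finally show ?thesis .
qed

text \<open>
  Replacing the integrand \<open>exp (- (a * sin t))\<close> by \<open>cos t * exp (- (a * sin t))\<close> gives an elementary integral;
  since \<open>1 - cos t \<le> (sin t)\<^sup>2\<close> the error is of order \<open>1 / a ^ 3\<close>.
\<close>
lemma mean_kernel_bounds:
  assumes a: "a > 0"
  shows "1 - exp (- a) \<le> pi * a / 2 * mean_kernel a" "pi * a / 2 * mean_kernel a \<le> 1 + 128 / a\<^sup>2"
proof -
  define f where "f = (\<lambda>t. exp (- (a * sin t)))"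
  define J where "J = integral {0..pi/2} f"
  have int: "g integrable_on {c..d}" if "\<And>A. continuous_on A g" for c d and g :: "real \<Rightarrow> real"
    using that by (rule integrable_continuous_real)
  have cf: "continuous_on A f" for A unfolding f_def by (intro continuous_intros)
  \<comment> \<open>The symmetry \<open>sin (pi - t) = sin t\<close>, realized as a reflection
    followed by a shift by \<open>pi\<close>.\<close>
  have "integral {pi/2..pi} f = J"
  proof -
    have "integral {pi/2..pi} f = integral {- pi..- (pi/2)} (\<lambda>x. f (- x))"
      by (rule Henstock_Kurzweil_Integration.integral_reflect_real[symmetric])
    also have "\<dots> = integral {0..pi/2} ((\<lambda>x. f (- x)) \<circ> (+) (- pi))"
      using integral_shift_Icc_real[of 0 "pi/2" "\<lambda>x. f (- x)" "- pi"] by simp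
    also have "\<dots> = J" by (simp add: J_def o_def f_def)
    finally show ?thesis .
  qed
  then have mean: "mean_kernel a = 2 * J / pi"
    using Henstock_Kurzweil_Integration.integral_combine[of 0 "pi/2" pi f] int[OF cf]
    by (simp add: mean_kernel_def f_def J_def)
  have cos_int: "((\<lambda>t. cos t * f t) has_integral (1 - exp (- a)) / a) {0..pi/2}"
  proof -
    have "((\<lambda>t. cos t * f t) has_integral (- exp (- (a * sin (pi/2))) / a - (- exp (- (a * sin 0)) / a))) {0..pi/2}"
      using a by (intro fundamental_theorem_of_calculus)
       (auto simp: f_def has_real_derivative_iff_has_vector_derivative[symmetric] intro!: derivative_eq_intros)
    then show ?thesis by (simp add: diff_divide_distrib)
  qed
  have exp_int: "((\<lambda>t. exp (- (a / 4 * t))) has_integral (4 / a - 4 / a * exp (- (a / 4 * (pi / 2))))) {0..pi/2}"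
  proof -
    have "((\<lambda>t. exp (- (a / 4 * t))) has_integral (- 4 / a * exp (- (a / 4 * (pi/2))) - (- 4 / a * exp (- (a / 4 * 0))))) {0..pi/2}"
      using a by (intro fundamental_theorem_of_calculus)
       (auto simp: has_real_derivative_iff_has_vector_derivative[symmetric] intro!: derivative_eq_intros)
    then show ?thesis by simp
  qed
  have "(1 - exp (- a)) / a \<le> J"
    unfolding J_def by (rule has_integral_le[OF cos_int integrable_integral[OF int[OF cf]]])
      (simp add: f_def)
  then show "1 - exp (- a) \<le> pi * a / 2 * mean_kernel a"
    using a by (simp add: mean field_simps)
  \<comment> \<open>With \<open>x = a * sin t / 2\<close>, \<open>f t\<close> is a product of two
    factors \<open>exp (- x)\<close>. One absorbs
    \<open>(sin t)\<^sup>2 = 4 / a\<^sup>2 * x\<^sup>2\<close> through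
    \<open>x\<^sup>2 * exp (- x) \<le> 8\<close>, whence \<open>32 = 4 * 8\<close>; the other decays
    in \<open>t\<close> by \<open>sin_ge_half\<close>.\<close>
  have pt: "f t \<le> cos t * f t + 32 / a\<^sup>2 * exp (- (a / 4 * t))" if t: "t \<in> {0..pi/2}" for t
  proof -
    have c: "0 \<le> cos t" "0 \<le> sin t" using t by (auto intro!: cos_ge_zero sin_ge_zero)
    have "1 - cos t \<le> (sin t)\<^sup>2"
      using c mult_right_mono[of "cos t" 1 "cos t"] sin_squared_eq[of t] by (simp add: power2_eq_square)
    then have "(1 - cos t) * f t \<le> (sin t)\<^sup>2 * f t"
      by (intro mult_right_mono) (auto simp: f_def)
    also have "\<dots> = (sin t)\<^sup>2 * exp (- (a * sin t / 2)) * exp (- (a * sin t / 2))"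
      by (simp add: f_def flip: exp_add)
    also have "\<dots> \<le> 32 / a\<^sup>2 * exp (- (a / 4 * t))"
    proof (rule mult_mono)
      define x where "x = a * sin t / 2"
      have x: "x \<ge> 0" using c a by (simp add: x_def)
      have "x\<^sup>2 / 2 \<le> exp x" using exp_lower_Taylor_quadratic[OF x] x by simp
      then have "x\<^sup>2 * exp (- x) \<le> 8" using x by (simp add: exp_minus field_simps) (smt (verit) exp_gt_zero)
      moreover have "(sin t)\<^sup>2 = 4 / a\<^sup>2 * x\<^sup>2" using a by (simp add: x_def power2_eq_square)
      ultimately show "(sin t)\<^sup>2 * exp (- (a * sin t / 2)) \<le> 32 / a\<^sup>2"
        using a unfolding x_def[symmetric] by (simp add: field_simps)
      show "exp (- (a * sin t / 2)) \<le> exp (- (a / 4 * t))"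
        using sin_ge_half[of t] t a by (simp add: field_simps)
    qed auto
    finally show ?thesis by (simp add: algebra_simps)
  qed
  \<comment> \<open>The exponential integrates to at most \<open>4 / a\<close>, so the error is at
    most \<open>128 / a ^ 3\<close>; multiplying by \<open>a\<close> leaves
    \<open>128 / a\<^sup>2\<close>.\<close>
  have "J \<le> (1 - exp (- a)) / a + 32 / a\<^sup>2 * (4 / a - 4 / a * exp (- (a / 4 * (pi / 2))))"
    unfolding J_def
    by (rule has_integral_le[OF integrable_integral[OF int[OF cf]] has_integral_add[OF cos_int has_integral_mult_right[OF exp_int]]])
      (rule pt)
  also have "\<dots> \<le> 1 / a + 32 / a\<^sup>2 * (4 / a)"
    using a by (intro add_mono mult_left_mono divide_right_mono) auto
  finally have "a * J \<le> a * (1 / a + 32 / a\<^sup>2 * (4 / a))"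
    using a by (intro mult_left_mono) auto
  also have "\<dots> = 1 + 128 / a\<^sup>2" using a by (simp add: field_simps)
  finally show "pi * a / 2 * mean_kernel a \<le> 1 + 128 / a\<^sup>2" by (simp add: mean mult_ac)
qed

text \<open>With \<open>c = pi * a / 2 * mean_kernel a\<close> the difference is
  \<open>pi * a / 2 * (1 / c - 1)\<close>. Since \<open>c\<close> exceeds \<open>1\<close> by at
  most \<open>128 / a\<^sup>2\<close> and falls below it by at most \<open>exp (- a)\<close>, the
  factor \<open>a\<close> is harmless.\<close>

lemma mean_kernel_asymptotics: "((\<lambda>a. 1 / mean_kernel a - pi * a / 2) \<longlongrightarrow> 0) at_top"
proof (rule tendsto_sandwich)
  let ?L = "\<lambda>a::real. pi * a / 2 * (1 / (1 + 128 / a\<^sup>2) - 1)"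
  let ?U = "\<lambda>a::real. pi * a / 2 * (1 / (1 - exp (- a)) - 1)"
  show "(?L \<longlongrightarrow> 0) at_top" by real_asymp
  show "(?U \<longlongrightarrow> 0) at_top" by real_asymp
  have "?L a \<le> 1 / mean_kernel a - pi * a / 2 \<and> 1 / mean_kernel a - pi * a / 2 \<le> ?U a" if a: "a > 0" for a
  proof -
    define c where "c = pi * a / 2 * mean_kernel a"
    have c: "c > 0" using mean_kernel_pos[of a] a by (simp add: c_def)
    have eq: "1 / mean_kernel a - pi * a / 2 = pi * a / 2 * (1 / c - 1)"
      using mean_kernel_pos[of a] a by (simp add: c_def field_simps)
    have b: "1 - exp (- a) \<le> c" "c \<le> 1 + 128 / a\<^sup>2"
      using mean_kernel_bounds[OF a] by (simp_all add: c_def)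
    have "1 / (1 + 128 / a\<^sup>2) \<le> 1 / c" "1 / c \<le> 1 / (1 - exp (- a))"
      using b c a by (auto intro!: divide_left_mono mult_pos_pos)
    then show ?thesis unfolding eq using a by (auto intro!: mult_left_mono)
  qed
  then show "\<forall>\<^sub>F a in at_top. ?L a \<le> 1 / mean_kernel a - pi * a / 2"
    "\<forall>\<^sub>F a in at_top. 1 / mean_kernel a - pi * a / 2 \<le> ?U a"
    by (auto intro!: eventually_mono[OF eventually_gt_at_top[of 0]])
qed

theorem theorem13:
  shows "\<exists>q3 :: real \<Rightarrow> real.
           (\<forall>l>0. magnitude (round_circle l) = ereal (l / 2 + q3 l)) \<and>
           (q3 \<longlongrightarrow> 0) at_top"
proof (intro exI conjI allI impI)
  \<comment> \<open>The circle has diameter \<open>l / pi\<close>, so the subtracted term is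
    \<open>l / 2\<close>.\<close>
  let ?q = "\<lambda>l. 1 / mean_kernel (l / pi) - pi * (l / pi) / 2"
  show "magnitude (round_circle l) = ereal (l / 2 + ?q l)" if "l > 0" for l
    using magnitude_round_circle[OF that] by simp
  have "filterlim (\<lambda>l::real. l / pi) at_top at_top" by real_asymp
  then show "(?q \<longlongrightarrow> 0) at_top"
    by (rule filterlim_compose[OF mean_kernel_asymptotics])
qed

end
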